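(* (a) Let $G$ be a simple graph with $n=|V(G)|\le 10$ vertices and let $P$ and $Q$ be two longest paths in $G$ with $V(Q)\neq V(P)$. Then $V(Q)\cap V(P)$ is a separator of $G$. (b) Moreover, there is a simple graph $G$ with $|V(G)|=11$ and two longest paths $P$ and $Q$ in $G$ with $V(Q)\neq V(P)$ such that $V(Q)\cap V(P)$ is not a separator of $G$. Consequently, $n=11$ is the minimal $n$ for which there exist a simple graph $G$ with $n$ vertices and two longest paths $P,Q$ in $G$ with $V(P)\neq V(Q)$ such that $V(P)\cap V(Q)$ is not a separator of $G$.
   Context: Graphs are finite, simple and undirected. A path has no repeated vertices; its length is its number of edges. A longest path in $G$ is a path in $G$ whose length is maximal among all paths in $G$. $V(P)$ denotes the vertex set of a path $P$. A set $W\subseteq V(G)$ is a separator of $G$ if its complement is not connected, i.e. if the graph $G\setminus W$ obtained by deleting the vertices of $W$ (and all edges incident with them) is not connected. *)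

theory Defs
  imports
    "Graph_Theory.Vertex_Walk"
    "Graph_Theory.Pair_Digraph"
    "Graph_Theory.Digraph_Component"
begin

(* A finite simple undirected graph is a pair_graph: a finite, loop-free, symmetric set of pairs
   over a finite vertex set, so that each undirected edge uv appears as both (u, v) and (v, u).
   A path is a vpath, i.e. a nonempty duplicate-free list of vertices, consecutive ones adjacent;
   the two orientations of a path are different lists with the same length and vertex set. *)

definition longest_path :: "'a pair_pre_digraph \<Rightarrow> 'a list \<Rightarrow> bool" where
  "longest_path G P \<longleftrightarrow>
     vpath P (with_proj G) \<and>
     (\<forall>Q. vpath Q (with_proj G) \<longrightarrow> vwalk_length Q \<le> vwalk_length P)"

(* The library's connected is false on the graph without vertices, so W = pverts G counts as a
   separator. This does not matter for an intersection of the vertex sets of two different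
   paths of equal length, whose complement is nonempty. *)
definition separator :: "'a pair_pre_digraph \<Rightarrow> 'a set \<Rightarrow> bool" where
  "separator G W \<longleftrightarrow>
     W \<subseteq> pverts G \<and> \<not> connected (with_proj G \<restriction> (pverts G - W))"

end

theory Submission
  imports Defs
begin

text \<open>
  Let \<open>P\<close> and \<open>Q\<close> be longest paths with \<open>k\<close> vertices each and \<open>m \<ge> 1\<close> private vertices each, and
  suppose that deleting the common vertices leaves a connected graph. Then some private vertex
  \<open>p\<close> of \<open>P\<close> is joined to some private vertex \<open>q\<close> of \<open>Q\<close> by a path outside \<open>P\<close> and \<open>Q\<close>, and this
  path may be treated as an edge. With at most ten vertices, \<open>k + m \<le> 10\<close>; the task
  is to find a longer path (\<open>no_bridge\<close>).

  If both \<open>p\<close> and \<open>q\<close> lie in parts at the ends of their paths that avoid the other path, the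
  ends can be exchanged (\<open>not_both_in_tails\<close>). So \<open>q\<close>, say, lies on \<open>Q\<close> between two vertices \<open>u\<close>
  and \<open>v\<close> of \<open>P\<close>. Exchanging stretches of \<open>P\<close> for stretches of \<open>Q\<close> shows that \<open>q\<close> is the only
  vertex between \<open>u\<close> and \<open>v\<close>, as otherwise \<open>k \<ge> 10\<close> (\<open>internal_block_trivial\<close>).
  Hence \<open>q\<close> is off the longest path \<open>P\<close> and has three neighbours \<open>p\<close>, \<open>u\<close>, \<open>v\<close> on it. They cut
  \<open>P\<close> into four nonempty segments, whence \<open>k \<ge> 7\<close>. By the standard rotation arguments the first
  vertices of the segments are independent, as are the last ones. Since the segments are short, this
  says that different segments are essentially not adjacent. But \<open>Q\<close> without \<open>u\<close>, \<open>q\<close>, \<open>v\<close>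
  consists of two paths only, and these cannot reach as many segments as they have to
  (\<open>no_path_through_two_neighbours\<close>).

  The bound is sharp because the Petersen graph is not Hamiltonian: delete one of its vertices and
  attach pendant vertices to two of the three former neighbours. This graph on eleven vertices has no
  Hamiltonian path, but it has paths that miss just the vertex \<open>2\<close> and paths that miss just the
  vertex \<open>10\<close>, and these two vertices are adjacent.
\<close>

section \<open>Independent sets and colourings along a path\<close>
fun evens :: "'a list \<Rightarrow> 'a list" where
  "evens [] = []"
| "evens [x] = [x]"
| "evens (x # y # zs) = x # evens zs"

text \<open>
  An independent set contains at most one of two consecutive vertices. The point is the equality
  case: on a path with an odd number of vertices, at most one independent set attains the bound.
\<close>
lemma independent_in_path_le:
  fixes E :: "'a \<Rightarrow> 'a \<Rightarrow> bool"
  assumes "distinct L" and "successively E L"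
    and "\<And>x y. x \<in> J \<Longrightarrow> y \<in> J \<Longrightarrow> x \<noteq> y \<Longrightarrow> \<not> E x y"
  shows "2 * card (J \<inter> set L) \<le> length L + 1 \<and>
    (2 * card (J \<inter> set L) = length L + 1 \<longrightarrow> J \<inter> set L = set (evens L))"
  using assms
proof (induction L rule: evens.induct)
  case 1
  then show ?case by simp
next
  case (2 x)
  then show ?case by (cases "x \<in> J") auto
next
  case (3 x y zs)
  have IH: "2 * card (J \<inter> set zs) \<le> length zs + 1"
    "2 * card (J \<inter> set zs) = length zs + 1 \<Longrightarrow> J \<inter> set zs = set (evens zs)"
    using 3 by (auto simp: successively_Cons)
  have notboth: "\<not> (x \<in> J \<and> y \<in> J)" using 3 by auto
  have split: "J \<inter> set (x # y # zs) = (J \<inter> {x, y}) \<union> (J \<inter> set zs)" by auto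
  have disj: "(J \<inter> {x, y}) \<inter> (J \<inter> set zs) = {}" using "3.prems" by auto
  have c: "card (J \<inter> set (x # y # zs)) = card (J \<inter> {x, y}) + card (J \<inter> set zs)"
    unfolding split using disj by (subst card_Un_disjoint) auto
  have two: "J \<inter> {x, y} = {} \<or> J \<inter> {x, y} = {x} \<or> J \<inter> {x, y} = {y}" using notboth by auto
  then have c1: "card (J \<inter> {x, y}) \<le> 1" by (elim disjE) auto
  show ?case
  proof (intro conjI impI)
    show "2 * card (J \<inter> set (x # y # zs)) \<le> length (x # y # zs) + 1"
      using c c1 IH(1) by simp
    assume eq: "2 * card (J \<inter> set (x # y # zs)) = length (x # y # zs) + 1"
    then have z: "2 * card (J \<inter> set zs) = length zs + 1" and one: "card (J \<inter> {x, y}) = 1"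
      using c c1 IH(1) by auto
    have ev: "J \<inter> set zs = set (evens zs)" using IH(2) z by simp
    have "y \<notin> J"
    proof
      assume y: "y \<in> J"
      have "zs \<noteq> []" using z by auto
      then obtain w ws where zs: "zs = w # ws" by (cases zs) auto
      have "w \<in> set (evens zs)" unfolding zs by (cases ws) auto
      then have "w \<in> J" using ev by auto
      moreover have "E y w" "y \<noteq> w" using "3.prems"(1,2) zs by auto
      ultimately show False using y "3.prems"(3) by blast
    qed
    moreover have "J \<inter> {x, y} \<noteq> {}" using one by (metis card.empty zero_neq_one)
    ultimately have "J \<inter> {x, y} = {x}" using two by auto
    then show "J \<inter> set (x # y # zs) = set (evens (x # y # zs))"
      using ev split by auto
  qed
qed

lemma constant_on_path:
  assumes "successively E L" and "\<And>x y. x \<in> set L \<Longrightarrow> y \<in> set L \<Longrightarrow> E x y \<Longrightarrow> f x = f y"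
    and "x \<in> set L"
  shows "f x = f (hd L)"
  using assms
proof (induction L arbitrary: x)
  case (Cons a L)
  show ?case
  proof (cases "x = a")
    case False
    then have x: "x \<in> set L" using Cons.prems by simp
    then have "L \<noteq> []" by auto
    have "f x = f (hd L)" using Cons.IH[OF _ _ x] Cons.prems by (auto simp: successively_Cons)
    also have "\<dots> = f a"
      using Cons.prems(1) Cons.prems(2)[of a "hd L"] \<open>L \<noteq> []\<close> by (simp add: successively_Cons)
    finally show ?thesis by simp
  qed simp
qed simp

text \<open>
  The order in which the three members occur is left open, since the arguments below treat
  the three neighbours of a vertex alike.
\<close>
lemma three_members_split:
  assumes "a \<in> set P" "b \<in> set P" "c \<in> set P" "a \<noteq> b" "a \<noteq> c" "b \<noteq> c"
  obtains A0 s1 A1 s2 A2 s3 A3 where "P = A0 @ s1 # A1 @ s2 # A2 @ s3 # A3"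
    "{s1, s2, s3} = {a, b, c}"
proof -
  have two: "\<exists>A s B t C. L = A @ s # B @ t # C \<and> {s, t} = {x, y}"
    if xy: "x \<in> set L" "y \<in> set L" "x \<noteq> y" for x y :: 'a and L
  proof -
    obtain L1 L2 where L: "L = L1 @ x # L2" using split_list[OF xy(1)] by blast
    then consider "y \<in> set L1" | "y \<in> set L2" using xy by auto
    then show ?thesis
    proof cases
      case 1
      then obtain M N where "L1 = M @ y # N" using split_list by metis
      then have "L = M @ y # N @ x # L2" using L by simp
      then show ?thesis by (metis insert_commute)
    next
      case 2
      then obtain M N where "L2 = M @ y # N" using split_list by metis
      then have "L = L1 @ x # M @ y # N" using L by simp
      then show ?thesis by metis
    qed
  qed
  obtain A s B t C where P: "P = A @ s # B @ t # C" and st: "{s, t} = {a, b}"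
    using two[OF assms(1,2,4)] by blast
  have "c \<noteq> s" "c \<noteq> t" using st assms by (metis insertI1 insert_iff singletonD)+
  then consider "c \<in> set A" | "c \<in> set B" | "c \<in> set C" using P assms(3) by auto
  then show ?thesis
  proof cases
    case 1
    then obtain M N where "A = M @ c # N" using split_list by metis
    then have "P = M @ c # N @ s # B @ t # C" using P by simp
    moreover have "{c, s, t} = {a, b, c}" using st by auto
    ultimately show ?thesis using that by blast
  next
    case 2
    then obtain M N where "B = M @ c # N" using split_list by metis
    then have "P = A @ s # M @ c # N @ t # C" using P by simp
    moreover have "{s, c, t} = {a, b, c}" using st by auto
    ultimately show ?thesis using that by blast
  next
    case 3
    then obtain M N where "C = M @ c # N" using split_list by metis
    then have "P = A @ s # B @ t # M @ c # N" using P by simp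
    moreover have "{s, t, c} = {a, b, c}" using st by auto
    ultimately show ?thesis using that by blast
  qed
qed

section \<open>Vertices off a longest path\<close>

text \<open>
  The combinatorial setting, detached from the ambient graph: no path of \<open>E\<close> inside \<open>V\<close>
  has more than \<open>k\<close> vertices. In the application \<open>E\<close> is the adjacency of a graph with one extra
  pair, which stands for a connecting path.
\<close>
locale path_bound =
  fixes E :: "'a \<Rightarrow> 'a \<Rightarrow> bool" and V :: "'a set" and k :: nat
  assumes sym: "E x y \<Longrightarrow> E y x"
    and bound: "distinct L \<Longrightarrow> successively E L \<Longrightarrow> set L \<subseteq> V \<Longrightarrow> length L \<le> k"
begin

definition path :: "'a list \<Rightarrow> bool" where
  "path L \<longleftrightarrow> distinct L \<and> successively E L \<and> set L \<subseteq> V"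

lemma sym_iff: "E x y \<longleftrightarrow> E y x"
  using sym by blast

lemma successively_rev_E [simp]: "successively E (rev L) = successively E L"
proof -
  have "(\<lambda>x y. E y x) = E" using sym by (intro ext) blast
  then show ?thesis by (simp only: successively_rev)
qed

lemma path_rev [simp]: "path (rev L) = path L"
  by (simp add: path_def del: successively_rev)

lemma path_length: "path L \<Longrightarrow> length L \<le> k"
  using bound by (auto simp: path_def)

text \<open>
  The three exchange arguments: replacing the end of a longest path, or a stretch between two of
  its vertices, by vertices off the path cannot gain anything.
\<close>
lemma tail_ge_pendant:
  assumes "path (X @ s # Y)" "length (X @ s # Y) = k"
    and "path M" "set M \<inter> set (X @ s # Y) = {}" "M \<noteq> []" "E s (hd M)"
  shows "length M \<le> length Y"
proof -
  have "path (X @ s # M)"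
    using assms by (auto simp: path_def successively_append_iff successively_Cons)
  then show ?thesis using path_length[of "X @ s # M"] assms(2) by simp
qed

lemma head_ge_pendant:
  assumes "path (X @ s # Y)" "length (X @ s # Y) = k"
    and "path M" "set M \<inter> set (X @ s # Y) = {}" "M \<noteq> []" "E s (hd M)"
  shows "length M \<le> length X"
  using tail_ge_pendant[of "rev Y" s "rev X" M] assms path_rev[of "X @ s # Y"]
  by (simp add: Un_commute)

lemma gap_ge_detour:
  assumes "path (X @ s # Y @ t # Z)" "length (X @ s # Y @ t # Z) = k"
    and "path M" "set M \<inter> set (X @ s # Y @ t # Z) = {}" "M \<noteq> []" "E s (hd M)" "E t (last M)"
  shows "length M \<le> length Y"
proof -
  have "path (X @ s # M @ t # Z)"
    using assms by (auto simp: path_def successively_append_iff successively_Cons sym_iff)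
  then show ?thesis using path_length[of "X @ s # M @ t # Z"] assms(2) by simp
qed

text \<open>
  If \<open>p\<close> is followed on its path only by vertices off the other path, and likewise \<open>q\<close>, then
  going over \<open>p\<close>--\<open>q\<close> and taking the other tail shows that each tail is longer than the other.
\<close>
lemma not_both_in_tails:
  assumes P: "path (P1 @ p # B)" "length (P1 @ p # B) = k"
    and Q: "path (Q1 @ q # D)" "length (Q1 @ q # D) = k"
    and pq: "E p q" "p \<notin> set (Q1 @ q # D)" "q \<notin> set (P1 @ p # B)"
    and B: "set B \<inter> set (Q1 @ q # D) = {}" and D: "set D \<inter> set (P1 @ p # B) = {}"
  shows False
proof -
  have "length (q # D) \<le> length B"
    by (rule tail_ge_pendant[OF P]) (use Q pq D in \<open>auto simp: path_def successively_append_iff\<close>)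
  moreover have "length (p # B) \<le> length D"
    by (rule tail_ge_pendant[OF Q])
      (use P pq B sym in \<open>auto simp: path_def successively_append_iff\<close>)
  ultimately show False by simp
qed


text \<open>
  Let \<open>C @ q # D\<close> be a stretch of the second path strictly between two vertices \<open>u\<close> and \<open>v\<close> of
  \<open>P\<close>. If it contains a vertex besides \<open>q\<close>, then, say, \<open>C\<close> is nonempty, and it supplies detours of
  at least two vertices between \<open>u\<close> and \<open>v\<close> and between \<open>p\<close> and \<open>u\<close>, one of at least one vertex
  between \<open>p\<close> and \<open>v\<close>, and a pendant path of two vertices at each of \<open>p\<close>, \<open>u\<close>, \<open>v\<close>. The path
  \<open>P\<close> must then have two vertices at each end and three in the two gaps, so ten in total.
\<close>
lemma internal_block_trivial:
  assumes P: "path P" "length P = k" "k \<le> 9"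
    and Q: "path (X @ u # C @ q # D @ v # Y)"
    and inP: "p \<in> set P" "u \<in> set P" "v \<in> set P"
    and out: "set (C @ q # D) \<inter> set P = {}" "p \<notin> set (X @ u # C @ q # D @ v # Y)"
    and pq: "E p q"
  shows "C = []"
proof (rule ccontr)
  assume C: "C \<noteq> []"
  define link where "link n s t \<longleftrightarrow>
    (\<exists>M. path M \<and> set M \<inter> set P = {} \<and> n \<le> length M \<and> M \<noteq> [] \<and> E s (hd M) \<and> E t (last M))"
    for n s t
  have link_sym: "link n s t \<Longrightarrow> link n t s" for n s t
    unfolding link_def
  proof (elim exE conjE)
    fix M assume "path M" "set M \<inter> set P = {}" "n \<le> length M" "M \<noteq> []" "E s (hd M)" "E t (last M)"
    then show "\<exists>M. path M \<and> set M \<inter> set P = {} \<and> n \<le> length M \<and> M \<noteq> [] \<and> E t (hd M) \<and> E s (last M)"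
      by (intro exI[of _ "rev M"]) (auto simp: hd_rev last_rev)
  qed
  have F: "path (C @ q # D)" and Cq: "path (C @ [q])" and qD: "path (q # D)"
    using Q by (auto simp: path_def successively_append_iff successively_Cons)
  have "path (rev (C @ [q]))" using Cq path_rev by blast
  then have qC: "path (q # rev C)" by simp
  have uC: "E u (hd C)" using Q C by (auto simp: path_def successively_append_iff successively_Cons)
  have vD: "E v (last (q # D))"
    using Q by (auto simp: path_def successively_append_iff successively_Cons sym_iff split: if_splits)
  have C1: "1 \<le> length C" using C by (cases C) auto
  have uv: "link 2 u v"
    unfolding link_def using F out uC vD C C1 by (intro exI[of _ "C @ q # D"]) auto
  have pu: "link 2 p u"
    unfolding link_def using qC out uC pq C C1
    by (intro exI[of _ "q # rev C"]) (auto simp: last_rev)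
  have pv: "link 1 p v"
    unfolding link_def using qD out pq vD by (intro exI[of _ "q # D"]) auto
  have mono: "link 2 s t \<Longrightarrow> link 1 s t" for s t
    unfolding link_def by (meson le_trans one_le_numeral)
  have distinct: "p \<noteq> u" "p \<noteq> v" "u \<noteq> v" using Q out by (auto simp: path_def)
  obtain A0 s1 A1 s2 A2 s3 A3 where
    split: "P = A0 @ s1 # A1 @ s2 # A2 @ s3 # A3" and S: "{s1, s2, s3} = {p, u, v}"
    using three_members_split[OF inP distinct] by blast
  have sd: "s1 \<noteq> s2" "s1 \<noteq> s3" "s2 \<noteq> s3" using P(1) split by (auto simp: path_def)
  have pendant: "\<exists>t. link 2 s t" if "s \<in> {p, u, v}" for s
    using that uv pu link_sym by blast
  have "2 \<le> length A0"
  proof -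
    obtain t where "link 2 s1 t" using pendant S by blast
    then obtain M where M: "path M" "set M \<inter> set P = {}" "2 \<le> length M" "M \<noteq> []" "E s1 (hd M)"
      unfolding link_def by blast
    have "length M \<le> length A0" using head_ge_pendant[of A0 s1] P M split by simp
    then show ?thesis using M by simp
  qed
  moreover have "2 \<le> length A3"
  proof -
    obtain t where "link 2 s3 t" using pendant S by blast
    then obtain M where M: "path M" "set M \<inter> set P = {}" "2 \<le> length M" "M \<noteq> []" "E s3 (hd M)"
      unfolding link_def by blast
    have "length M \<le> length A3"
      using tail_ge_pendant[of "A0 @ s1 # A1 @ s2 # A2" s3 A3] P M split by simp
    then show ?thesis using M by simp
  qed
  moreover have l1: "n \<le> length A1" if l: "link n s1 s2" for n
  proof -
    obtain M where M: "path M" "set M \<inter> set P = {}" "n \<le> length M" "M \<noteq> []" "E s1 (hd M)" "E s2 (last M)"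
      using l unfolding link_def by blast
    have "length M \<le> length A1"
      using gap_ge_detour[of A0 s1 A1 s2 "A2 @ s3 # A3"] P M split by simp
    then show ?thesis using M by simp
  qed
  moreover have l2: "n \<le> length A2" if l: "link n s2 s3" for n
  proof -
    obtain M where M: "path M" "set M \<inter> set P = {}" "n \<le> length M" "M \<noteq> []" "E s2 (hd M)" "E s3 (last M)"
      using l unfolding link_def by blast
    have "length M \<le> length A2"
      using gap_ge_detour[of "A0 @ s1 # A1" s2 A2 s3 A3] P M split by simp
    then show ?thesis using M by simp
  qed
  \<comment> \<open>Whatever the order on \<open>P\<close>, the vertex \<open>u\<close> borders one of the two gaps, and the detours
      at \<open>u\<close> are the ones of two vertices.\<close>
  have "3 \<le> length A1 + length A2"
  proof -
    have all1: "link 1 s t" if "s \<in> {p, u, v}" "t \<in> {p, u, v}" "s \<noteq> t" for s t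
      using that uv pu pv link_sym mono by (elim insertE emptyE) blast+
    have all2: "link 2 s t" if "s \<in> {p, u, v}" "t \<in> {p, u, v}" "s \<noteq> t" "u \<in> {s, t}" for s t
      using that uv pu link_sym distinct by (elim insertE emptyE) blast+
    have s: "s1 \<in> {p, u, v}" "s2 \<in> {p, u, v}" "s3 \<in> {p, u, v}" using S by blast+
    have one: "1 \<le> length A1" "1 \<le> length A2" using l1 l2 all1 s sd by blast+
    have "u \<in> {s1, s2} \<or> u \<in> {s2, s3}" using S by blast
    then have "2 \<le> length A1 \<or> 2 \<le> length A2" using l1 l2 all2 s sd by blast
    then show ?thesis using one by linarith
  qed
  ultimately have "10 \<le> length P" using split by simp
  then show False using P by simp
qed

text \<open>
  The classical rotation arguments: if \<open>q\<close> lies off a longest path, then the start of the path and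
  the successors of the neighbours of \<open>q\<close> are pairwise nonadjacent. An edge between two successors
  lets the path run through \<open>q\<close> and traverse the part between the two neighbours backwards.
\<close>
lemma heads_nonadjacent_inner:
  assumes "path (X @ s # Y @ t # Z)" "length (X @ s # Y @ t # Z) = k"
    and "q \<in> V" "q \<notin> set (X @ s # Y @ t # Z)" "E q s" "E q t" "Y \<noteq> []" "Z \<noteq> []"
  shows "\<not> E (hd Y) (hd Z)"
proof
  assume "E (hd Y) (hd Z)"
  then have "path (X @ s # q # t # rev Y @ Z)"
    using assms
    by (auto simp: path_def successively_append_iff successively_Cons hd_rev last_rev sym_iff)
  then show False using path_length[of "X @ s # q # t # rev Y @ Z"] assms(2) by simp
qed

lemma heads_nonadjacent_first:
  assumes "path (X @ s # Y)" "length (X @ s # Y) = k"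
    and "q \<in> V" "q \<notin> set (X @ s # Y)" "E q s" "X \<noteq> []" "Y \<noteq> []"
  shows "\<not> E (hd X) (hd Y)"
proof
  assume "E (hd X) (hd Y)"
  then have "path (q # s # rev X @ Y)"
    using assms
    by (auto simp: path_def successively_append_iff successively_Cons hd_rev last_rev sym_iff)
  then show False using path_length[of "q # s # rev X @ Y"] assms(2) by simp
qed

text \<open>
  A second vertex \<open>y\<close> off the path: starting at \<open>y\<close>, the path can collect both \<open>y\<close> and \<open>q\<close>, and it
  gives up only the final part \<open>Z\<close>. So when \<open>Z\<close> is a single vertex, one vertex is gained.
\<close>
lemma head_nonadjacent_outside:
  assumes "path (X @ s # Y @ t # Z)" "length (X @ s # Y @ t # Z) = k" "length Z = 1"
    and "q \<in> V" "q \<notin> set (X @ s # Y @ t # Z)" "E q s" "E q t" "Y \<noteq> []"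
    and "y \<in> V" "y \<notin> set (X @ s # Y @ t # Z)" "y \<noteq> q"
  shows "\<not> E y (hd Y)"
proof
  assume "E y (hd Y)"
  then have "path (y # Y @ t # q # s # rev X)"
    using assms
    by (auto simp: path_def successively_append_iff successively_Cons hd_rev last_rev sym_iff)
  then show False using path_length[of "y # Y @ t # q # s # rev X"] assms(2,3) by simp
qed

end

section \<open>A longest path with a vertex off it that has three neighbours on it\<close>

text \<open>
  Removing the neighbours \<open>s1\<close>, \<open>s2\<close>, \<open>s3\<close> of \<open>q\<close> leaves four segments of the path.
\<close>
locale three_neighbours = path_bound +
  fixes A0 :: "'a list" and s1 :: 'a and A1 :: "'a list" and s2 :: 'a and A2 :: "'a list"
    and s3 :: 'a and A3 :: "'a list" and q :: 'a
  assumes P: "path (A0 @ s1 # A1 @ s2 # A2 @ s3 # A3)"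
    and len: "length (A0 @ s1 # A1 @ s2 # A2 @ s3 # A3) = k"
    and qV: "q \<in> V" and qP: "q \<notin> set (A0 @ s1 # A1 @ s2 # A2 @ s3 # A3)"
    and qs: "E q s1" "E q s2" "E q s3"
begin

abbreviation "P \<equiv> A0 @ s1 # A1 @ s2 # A2 @ s3 # A3"

definition seg :: "nat \<Rightarrow> 'a list" where
  "seg i = [A0, A1, A2, A3] ! i"

lemma seg_simps [simp]: "seg 0 = A0" "seg (Suc 0) = A1" "seg 2 = A2" "seg 3 = A3"
  by (simp_all add: seg_def)

lemma less_4_cases: "(i::nat) < 4 \<longleftrightarrow> i = 0 \<or> i = Suc 0 \<or> i = 2 \<or> i = 3"
  by auto

text \<open>
  Reversing the path exchanges first and last vertices of the segments, so that each statement about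
  first vertices yields one about last vertices.
\<close>
lemma mirror: "three_neighbours E V k (rev A3) s3 (rev A2) s2 (rev A1) s1 (rev A0) q"
proof unfold_locales
  have r: "rev A3 @ s3 # rev A2 @ s2 # rev A1 @ s1 # rev A0 = rev P" by simp
  show "path (rev A3 @ s3 # rev A2 @ s2 # rev A1 @ s1 # rev A0)"
    unfolding r path_rev by (rule P)
  show "length (rev A3 @ s3 # rev A2 @ s2 # rev A1 @ s1 # rev A0) = k"
    unfolding r using len by simp
  show "q \<notin> set (rev A3 @ s3 # rev A2 @ s2 # rev A1 @ s1 # rev A0)"
    unfolding r using qP by simp
qed (use qV qs in auto)

lemma seg_mirror:
  "i < 4 \<Longrightarrow> three_neighbours.seg (rev A3) (rev A2) (rev A1) (rev A0) i = rev (seg (3 - i))"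
  by (auto simp: three_neighbours.seg_def[OF mirror] less_4_cases seg_def)

lemma q_path: "path [q]"
  using qV by (simp add: path_def)

lemma seg_nonempty: "i < 4 \<Longrightarrow> seg i \<noteq> []"
proof -
  have ne: "s1 \<noteq> q" "s2 \<noteq> q" "s3 \<noteq> q" using qP by auto
  have "length [q] \<le> length A0"
    using head_ge_pendant[of A0 s1 "A1 @ s2 # A2 @ s3 # A3" "[q]"] P len q_path qP ne sym[OF qs(1)] sym[OF qs(2)] sym[OF qs(3)] qs by simp
  moreover have "length [q] \<le> length A3"
    using tail_ge_pendant[of "A0 @ s1 # A1 @ s2 # A2" s3 A3 "[q]"] P len q_path qP ne sym[OF qs(1)] sym[OF qs(2)] sym[OF qs(3)] qs by simp
  moreover have "length [q] \<le> length A1"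
    using gap_ge_detour[of A0 s1 A1 s2 "A2 @ s3 # A3" "[q]"] P len q_path qP ne sym[OF qs(1)] sym[OF qs(2)] sym[OF qs(3)] qs by simp
  moreover have "length [q] \<le> length A2"
    using gap_ge_detour[of "A0 @ s1 # A1" s2 A2 s3 A3 "[q]"] P len q_path qP ne sym[OF qs(1)] sym[OF qs(2)] sym[OF qs(3)] qs by simp
  ultimately show "i < 4 \<Longrightarrow> seg i \<noteq> []" by (auto simp: less_4_cases)
qed

lemma A_nonempty: "A0 \<noteq> []" "A1 \<noteq> []" "A2 \<noteq> []" "A3 \<noteq> []"
  using seg_nonempty[of 0] seg_nonempty[of 1] seg_nonempty[of 2] seg_nonempty[of 3] by auto

lemma seg_lengths: "length A0 + length A1 + length A2 + length A3 + 3 = k"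
  "1 \<le> length A0" "1 \<le> length A1" "1 \<le> length A2" "1 \<le> length A3"
  using len A_nonempty by (auto simp: Suc_le_eq)

lemma heads_nonadjacent:
  assumes "i < 4" "j < 4" "i \<noteq> j"
  shows "\<not> E (hd (seg i)) (hd (seg j))"
proof -
  note ne = A_nonempty
  have "\<not> E (hd A0) (hd A1)"
    using heads_nonadjacent_first[of A0 s1 "A1 @ s2 # A2 @ s3 # A3" q] P len qV qP qs ne by simp
  moreover have "\<not> E (hd A0) (hd A2)"
    using heads_nonadjacent_first[of "A0 @ s1 # A1" s2 "A2 @ s3 # A3" q] P len qV qP qs ne by simp
  moreover have "\<not> E (hd A0) (hd A3)"
    using heads_nonadjacent_first[of "A0 @ s1 # A1 @ s2 # A2" s3 A3 q] P len qV qP qs ne by simp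
  moreover have "\<not> E (hd A1) (hd A2)"
    using heads_nonadjacent_inner[of A0 s1 A1 s2 "A2 @ s3 # A3" q] P len qV qP qs ne by simp
  moreover have "\<not> E (hd A1) (hd A3)"
    using heads_nonadjacent_inner[of A0 s1 "A1 @ s2 # A2" s3 A3 q] P len qV qP qs ne by simp
  moreover have "\<not> E (hd A2) (hd A3)"
    using heads_nonadjacent_inner[of "A0 @ s1 # A1" s2 A2 s3 A3 q] P len qV qP qs ne by simp
  ultimately show ?thesis using assms sym by (auto simp: less_4_cases)
qed

lemma lasts_nonadjacent:
  assumes "i < 4" "j < 4" "i \<noteq> j"
  shows "\<not> E (last (seg i)) (last (seg j))"
proof -
  have "3 - (3 - i) = i" "3 - (3 - j) = j" using assms by auto
  then show ?thesis
    using three_neighbours.heads_nonadjacent[OF mirror, of "3 - i" "3 - j"] assms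
    by (auto simp: seg_mirror hd_rev)
qed

lemma q_nonadjacent_head: "i < 4 \<Longrightarrow> \<not> E q (hd (seg i))"
proof -
  note ne = A_nonempty
  have nq: "s1 \<noteq> q" "s2 \<noteq> q" "s3 \<noteq> q" using qP by auto
  have "\<not> E q (hd A0)"
  proof
    assume "E q (hd A0)"
    then have "path (q # P)" using P qV qP ne by (simp add: path_def successively_Cons)
    then show False using path_length[of "q # P"] len by simp
  qed
  moreover have "\<not> E q (hd A1)"
  proof
    assume a: "E q (hd A1)"
    obtain a B where A1: "A1 = a # B" using ne by (cases A1) auto
    have aq: "a \<noteq> q" using A1 qP by auto
    show False
      using gap_ge_detour[of A0 s1 "[]" a "B @ s2 # A2 @ s3 # A3" "[q]"] P len q_path qP qs a qs(1-3)[THEN sym] nq sym[OF a] aq A1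
      by simp
  qed
  moreover have "\<not> E q (hd A2)"
  proof
    assume a: "E q (hd A2)"
    obtain a B where A2: "A2 = a # B" using ne by (cases A2) auto
    have aq: "a \<noteq> q" using A2 qP by auto
    show False
      using gap_ge_detour[of "A0 @ s1 # A1" s2 "[]" a "B @ s3 # A3" "[q]"] P len q_path qP qs a qs(1-3)[THEN sym] nq sym[OF a] aq A2
      by simp
  qed
  moreover have "\<not> E q (hd A3)"
  proof
    assume a: "E q (hd A3)"
    obtain a B where A3: "A3 = a # B" using ne by (cases A3) auto
    have aq: "a \<noteq> q" using A3 qP by auto
    show False
      using gap_ge_detour[of "A0 @ s1 # A1 @ s2 # A2" s3 "[]" a B "[q]"] P len q_path qP qs a qs(1-3)[THEN sym] nq sym[OF a] aq A3
      by simp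
  qed
  ultimately show "i < 4 \<Longrightarrow> \<not> E q (hd (seg i))" by (auto simp: less_4_cases)
qed

lemma q_nonadjacent_last: "i < 4 \<Longrightarrow> \<not> E q (last (seg i))"
  using three_neighbours.q_nonadjacent_head[OF mirror, of "3 - i"] by (auto simp: seg_mirror hd_rev)

lemma outside_nonadjacent_hd:
  assumes y: "y \<in> V" "y \<notin> set P" "y \<noteq> q"
  shows "\<not> E y (hd A0)" and "length A3 = 1 \<Longrightarrow> \<not> E y (hd A1)" and "length A3 = 1 \<Longrightarrow> \<not> E y (hd A2)"
proof -
  note ne = A_nonempty
  show "\<not> E y (hd A0)"
  proof
    assume "E y (hd A0)"
    then have "path (y # P)" using P y ne by (simp add: path_def successively_Cons)
    then show False using path_length[of "y # P"] len by simp
  qed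
  show "length A3 = 1 \<Longrightarrow> \<not> E y (hd A1)"
    using head_nonadjacent_outside[of A0 s1 "A1 @ s2 # A2" s3 A3 q y] P len qV qP qs ne y by simp
  show "length A3 = 1 \<Longrightarrow> \<not> E y (hd A2)"
    using head_nonadjacent_outside[of "A0 @ s1 # A1" s2 A2 s3 A3 q y] P len qV qP qs ne y by simp
qed

lemma outside_nonadjacent_last:
  assumes y: "y \<in> V" "y \<notin> set P" "y \<noteq> q"
  shows "\<not> E y (last A3)" and "length A0 = 1 \<Longrightarrow> \<not> E y (last A2)" and "length A0 = 1 \<Longrightarrow> \<not> E y (last A1)"
  using three_neighbours.outside_nonadjacent_hd[OF mirror, of y] y by (auto simp: hd_rev)


lemma in_P_iff: "z \<in> set P \<longleftrightarrow> z \<in> {s1, s2, s3} \<or> (\<exists>i<4. z \<in> set (seg i))"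
proof -
  have "(\<exists>i<4. z \<in> set (seg i)) \<longleftrightarrow> z \<in> set A0 \<or> z \<in> set A1 \<or> z \<in> set A2 \<or> z \<in> set A3"
    by (simp add: less_4_cases ex_disj_distrib conj_disj_distribR)
  then show ?thesis by simp
qed

lemma A_disjoint:
  "set A0 \<inter> set A1 = {}" "set A0 \<inter> set A2 = {}" "set A0 \<inter> set A3 = {}"
  "set A1 \<inter> set A2 = {}" "set A1 \<inter> set A3 = {}" "set A2 \<inter> set A3 = {}"
  using P by (auto simp: path_def)

lemma seg_disjoint:
  assumes "i < 4" "j < 4" "z \<in> set (seg i)" "z \<in> set (seg j)"
  shows "i = j"
proof (rule ccontr)
  assume "i \<noteq> j"
  have "set (seg i) \<inter> set (seg j) = {}"
    using assms(1,2) \<open>i \<noteq> j\<close> A_disjoint unfolding less_4_cases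
    by (elim disjE) (simp_all add: Int_commute)
  then show False using assms(3,4) by blast
qed

lemma seg_in_P:
  assumes "i < 4" "z \<in> set (seg i)"
  shows "z \<in> set P - {s1, s2, s3}"
proof -
  have "s1 \<notin> set (seg i)" "s2 \<notin> set (seg i)" "s3 \<notin> set (seg i)" "set (seg i) \<subseteq> set P"
    using assms(1) P unfolding less_4_cases by (elim disjE; simp add: path_def; blast)+
  then show ?thesis using assms(2) by blast
qed

lemma singleton_hd_last: "length L = 1 \<Longrightarrow> z \<in> set L \<Longrightarrow> z = hd L \<and> z = last L"
  by (cases L) auto

lemma hd_or_last: "length L \<le> 2 \<Longrightarrow> z \<in> set L \<Longrightarrow> z = hd L \<or> z = last L"
  by (cases L rule: evens.cases) auto

text \<open>
  On at most eight vertices the four segments have at most five vertices, so of any two segments one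
  is a single vertex, which is both first and last, and the other consists of a first and a last
  vertex.
\<close>
lemma segs_nonadjacent:
  assumes "k \<le> 8" "i < 4" "j < 4" "i \<noteq> j" and x: "x \<in> set (seg i)" and y: "y \<in> set (seg j)"
  shows "\<not> E x y"
proof -
  have *: "\<not> E x y" if "length (seg j) = 1" "length (seg i) \<le> 2" "i < 4" "j < 4" "i \<noteq> j"
      "x \<in> set (seg i)" "y \<in> set (seg j)" for i j x y
    using singleton_hd_last[OF that(1,7)] hd_or_last[OF that(2,6)]
      heads_nonadjacent[OF that(3,4,5)] lasts_nonadjacent[OF that(3,4,5)] by auto
  have "length (seg j) = 1 \<and> length (seg i) \<le> 2 \<or> length (seg i) = 1 \<and> length (seg j) \<le> 2"
    using seg_lengths assms(1-4) by (auto simp: less_4_cases)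
  then show ?thesis using *[of j i x y] *[of i j y x] assms sym by blast
qed

text \<open>
  A colouring that is constant along edges avoiding \<open>q\<close> and its three neighbours, as long as \<open>k\<close>
  is at most 8. The vertices off the path share the colour of an end segment of two vertices, the only
  segment they may be adjacent to, and have a colour of their own if there is no such segment.
\<close>
definition class_of :: "'a \<Rightarrow> nat" where
  "class_of z =
    (if z \<in> set A0 then 0 else if z \<in> set A1 then 1 else if z \<in> set A2 then 2
     else if z \<in> set A3 then 3 else if length A0 \<ge> 2 then 0 else if length A3 \<ge> 2 then 3 else 4)"

lemma class_of_seg:
  assumes "i < 4" "z \<in> set (seg i)"
  shows "class_of z = i"
proof -
  have "z \<notin> set (seg j)" if "j < 4" "j \<noteq> i" for j
    using seg_disjoint that assms by blast
  from this[of 0] this[of 1] this[of 2] this[of 3] show ?thesis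
    using assms unfolding less_4_cases by (elim disjE) (simp_all add: class_of_def)
qed

lemma class_of_outside:
  assumes "k \<le> 8" "y \<in> V" "y \<notin> set P" "y \<noteq> q" "i < 4" "x \<in> set (seg i)" "E y x"
  shows "class_of y = i"
proof -
  have y: "y \<in> V" "y \<notin> set P" "y \<noteq> q" by fact+
  note hds = outside_nonadjacent_hd[OF y] and lasts = outside_nonadjacent_last[OF y]
  have out: "y \<notin> set A0" "y \<notin> set A1" "y \<notin> set A2" "y \<notin> set A3" using y by auto
  consider "i = 0" "x \<in> set A0" | "i = 1" "x \<in> set A1" | "i = 2" "x \<in> set A2" | "i = 3" "x \<in> set A3"
    using assms(5,6) by (auto simp: less_4_cases)
  then show ?thesis
  proof cases
    case 1
    then have "length A0 \<noteq> 1" using singleton_hd_last[of A0 x] hds(1) assms(7) by auto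
    then show ?thesis using 1 out seg_lengths by (simp add: class_of_def)
  next
    case 4
    then have "length A3 \<noteq> 1" using singleton_hd_last[of A3 x] lasts(1) assms(7) by auto
    then show ?thesis using 4 out seg_lengths assms(1) by (simp add: class_of_def)
  next
    case 2
    have "length A0 = 1 \<and> length A3 = 1 \<and> length A1 \<le> 2 \<or> length A1 = 1 \<and> (length A0 = 1 \<or> length A3 = 1)"
      using seg_lengths assms(1) by linarith
    then have False
      using singleton_hd_last[of A1 x] hd_or_last[of A1 x] 2 hds(2) lasts(3) assms(7) by auto
    then show ?thesis ..
  next
    case 3
    have "length A0 = 1 \<and> length A3 = 1 \<and> length A2 \<le> 2 \<or> length A2 = 1 \<and> (length A0 = 1 \<or> length A3 = 1)"
      using seg_lengths assms(1) by linarith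
    then have False
      using singleton_hd_last[of A2 x] hd_or_last[of A2 x] 3 hds(3) lasts(2) assms(7) by auto
    then show ?thesis ..
  qed
qed

text \<open>
  Here \<open>u\<close> and \<open>v\<close> are the neighbours of \<open>q\<close> on the second path, and \<open>m\<close> is the number of vertices
  of each path off the other. The four segments have at least four vertices, so \<open>k\<close> is at least 7.

  For \<open>m = 1\<close> the second path contains all four segments. Their first vertices together with \<open>q\<close> are
  five independent vertices on a path with at most nine vertices, hence exactly its odd places, and
  so are the last vertices together with \<open>q\<close>. First and last vertices therefore agree and
  all segments are single vertices, so \<open>k = 7\<close>, which is too short for five independent vertices.

  For \<open>m \<ge> 2\<close> one has \<open>k \<le> 8\<close>, and \<open>X\<close> and \<open>Y\<close> are monochromatic, so they show at most two
  colours. But at most \<open>m - 1\<close> segments miss the second path, because \<open>p\<close> lies in none of them. This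
  leaves at least three colours, where for \<open>m = 3\<close> (and \<open>k = 7\<close>) the third one
  is that of a vertex off the first path.
\<close>
lemma no_path_through_two_neighbours:
  assumes Q: "path (X @ [u, q, v] @ Y)" "length (X @ [u, q, v] @ Y) = k"
    and S: "{s1, s2, s3} = {p, u, v}" and p: "p \<notin> set (X @ [u, q, v] @ Y)"
    and c: "card (set P \<union> set (X @ [u, q, v] @ Y)) \<le> 10"
  shows False
proof -
  define QQ where "QQ = X @ [u, q, v] @ Y"
  define N where "N = set P - set QQ"
  define m where "m = card N"
  have dP: "distinct P" and dQ: "distinct QQ" using P Q(1) by (auto simp: path_def QQ_def)
  have cP: "card (set P) = k" using dP len distinct_card by metis
  have cQ: "card (set QQ) = k" using dQ Q(2) distinct_card QQ_def by metis
  have "card (set P \<union> set QQ) = card (set QQ) + m"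
    unfolding m_def N_def by (subst card_Un_disjoint[symmetric]) (auto intro: arg_cong[where f = card])
  then have km: "k + m \<le> 10" using c cQ by (simp add: QQ_def)
  have "card (set P \<inter> set QQ) + card (set P - set QQ) = k"
    using card_Int_Diff[of "set P" "set QQ"] cP by simp
  moreover have "card (set P \<inter> set QQ) + card (set QQ - set P) = k"
    using card_Int_Diff[of "set QQ" "set P"] cQ by (simp add: Int_commute)
  ultimately have cQP: "card (set QQ - set P) = m" by (simp add: m_def N_def)
  have pS: "p \<in> {s1, s2, s3}" and uvS: "u \<in> {s1, s2, s3}" "v \<in> {s1, s2, s3}" using S by auto
  have pN: "p \<in> N" using pS p by (auto simp: N_def QQ_def)
  have finN: "finite N" by (simp add: N_def)
  have k7: "7 \<le> k" using seg_lengths by linarith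
  have m1: "1 \<le> m" using pN finN by (auto simp: m_def Suc_le_eq card_gt_0_iff)
  have segQ: "z \<in> set X \<union> set Y" if "i < 4" "z \<in> set (seg i)" "z \<in> set QQ" for i z
    using that seg_in_P[OF that(1,2)] uvS qP by (auto simp: QQ_def)
  have hd_seg: "hd (seg i) \<in> set (seg i)" "last (seg i) \<in> set (seg i)" if "i < 4" for i
    using seg_nonempty[OF that] by auto
  show False
  proof (cases "m = 1")
    case True
    then have "N = {p}" using pN by (auto simp: m_def card_1_singleton_iff)
    then have sub: "z \<in> set QQ" if "i < 4" "z \<in> set (seg i)" for i z
      using seg_in_P[OF that] pS by (auto simp: N_def)
    \<comment> \<open>Used for the first and for the last vertices of the segments.\<close>
    have ev: "k = 9 \<and> insert q (g ` {..<4}) = set (evens QQ)"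
      if g: "\<And>i. i < 4 \<Longrightarrow> g i \<in> set (seg i)" and q: "\<And>i. i < 4 \<Longrightarrow> \<not> E q (g i)"
        and n: "\<And>i j. i < 4 \<Longrightarrow> j < 4 \<Longrightarrow> i \<noteq> j \<Longrightarrow> \<not> E (g i) (g j)" for g
    proof -
      let ?J = "insert q (g ` {..<4})"
      have inj: "inj_on g {..<4}"
        using g seg_disjoint by (metis inj_onI lessThan_iff)
      have "q \<notin> g ` {..<4}" using g seg_in_P qP by blast
      then have cJ: "card ?J = 5" using inj by (simp add: card_image)
      have sQ: "?J \<subseteq> set QQ" using sub g by (auto simp: QQ_def)
      have ind: "\<not> E x y" if xy: "x \<in> ?J" "y \<in> ?J" "x \<noteq> y" for x y
      proof -
        consider "x = q" "y \<in> g ` {..<4}" | "y = q" "x \<in> g ` {..<4}"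
          | i j where "i < 4" "j < 4" "x = g i" "y = g j"
          using xy by auto
        then show ?thesis
        proof cases
          case 1
          then show ?thesis using q by auto
        next
          case 2
          then show ?thesis using q sym by auto
        next
          case 3
          then show ?thesis using n xy(3) by metis
        qed
      qed
      have suc: "successively E QQ" using Q(1) by (simp add: path_def QQ_def)
      have JQ: "?J \<inter> set QQ = ?J" using sQ by blast
      have lQ: "length QQ = k" using Q(2) by (simp add: QQ_def)
      have "2 * card ?J \<le> k + 1 \<and> (2 * card ?J = k + 1 \<longrightarrow> ?J = set (evens QQ))"
        using independent_in_path_le[OF dQ suc, of ?J, OF ind] unfolding JQ lQ by blast
      then show ?thesis using cJ km m1 by auto
    qed
    have 1: "k = 9 \<and> insert q ((\<lambda>i. hd (seg i)) ` {..<4}) = set (evens QQ)"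
      by (rule ev) (simp_all add: hd_seg heads_nonadjacent q_nonadjacent_head)
    have 2: "k = 9 \<and> insert q ((\<lambda>i. last (seg i)) ` {..<4}) = set (evens QQ)"
      by (rule ev) (simp_all add: hd_seg lasts_nonadjacent q_nonadjacent_last)
    have "length (seg i) = 1" if i: "i < 4" for i
    proof -
      have "hd (seg i) \<in> insert q ((\<lambda>i. last (seg i)) ` {..<4})" using 1 2 i by auto
      moreover have "hd (seg i) \<noteq> q" using seg_in_P[OF i hd_seg(1)[OF i]] qP by auto
      ultimately obtain j where j: "j < 4" "hd (seg i) = last (seg j)" by auto
      then have "j = i" using seg_disjoint hd_seg i by metis
      then have hl: "hd (seg i) = last (seg i)" using j by simp
      have "distinct (seg i)" using dP i by (auto simp: less_4_cases)
      then show ?thesis using hl seg_nonempty[OF i]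
        by (cases "seg i") (auto split: if_splits dest: last_in_set)
    qed
    from this[of 0] this[of 1] this[of 2] this[of 3] show False
      using 1 seg_lengths by simp
  next
    case False
    then have k8: "k \<le> 8" using km m1 by auto
    have same: "class_of x = class_of y"
      if "x \<in> set X \<union> set Y" "y \<in> set X \<union> set Y" "E x y" for x y
    proof -
      have xy: "z \<in> V \<and> z \<noteq> q \<and> z \<notin> {s1, s2, s3}" if "z \<in> set X \<union> set Y" for z
        using that Q(1) p S by (auto simp: path_def)
      have cx: "z \<notin> set P \<or> (\<exists>i<4. z \<in> set (seg i))" if "z \<in> set X \<union> set Y" for z
        using xy[OF that] by (metis in_P_iff)
      show ?thesis
      proof (cases "x \<in> set P"; cases "y \<in> set P")
        assume "x \<in> set P" "y \<in> set P"
        then obtain i j where "i < 4" "x \<in> set (seg i)" "j < 4" "y \<in> set (seg j)"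
          using cx \<open>x \<in> set X \<union> set Y\<close> \<open>y \<in> set X \<union> set Y\<close> by blast
        then show ?thesis using segs_nonadjacent[OF k8] \<open>E x y\<close> class_of_seg by metis
      next
        assume "x \<in> set P" "y \<notin> set P"
        then obtain i where "i < 4" "x \<in> set (seg i)" using cx \<open>x \<in> set X \<union> set Y\<close> by blast
        then show ?thesis
          using class_of_outside[OF k8 _ \<open>y \<notin> set P\<close>] xy[OF \<open>y \<in> set X \<union> set Y\<close>] sym[OF \<open>E x y\<close>]
            class_of_seg by metis
      next
        assume "x \<notin> set P" "y \<in> set P"
        then obtain i where "i < 4" "y \<in> set (seg i)" using cx \<open>y \<in> set X \<union> set Y\<close> by blast
        then show ?thesis
          using class_of_outside[OF k8 _ \<open>x \<notin> set P\<close>] xy[OF \<open>x \<in> set X \<union> set Y\<close>] \<open>E x y\<close>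
            class_of_seg by metis
      next
        assume "x \<notin> set P" "y \<notin> set P"
        then show ?thesis by (auto simp: class_of_def)
      qed
    qed
    have sX: "successively E X" and sY: "successively E Y"
      using Q(1) by (auto simp: path_def successively_append_iff successively_Cons)
    have "class_of ` (set X \<union> set Y) \<subseteq> {class_of (hd X), class_of (hd Y)}"
    proof -
      have "class_of z = class_of (hd X)" if "z \<in> set X" for z
        by (rule constant_on_path[OF sX _ that]) (use same in blast)
      moreover have "class_of z = class_of (hd Y)" if "z \<in> set Y" for z
        by (rule constant_on_path[OF sY _ that]) (use same in blast)
      ultimately show ?thesis by blast
    qed
    then have "card (class_of ` (set X \<union> set Y)) \<le> card {class_of (hd X), class_of (hd Y)}"
      by (intro card_mono) simp_all
    also have "\<dots> \<le> 2" by (simp add: card_insert_if)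
    finally have two: "card (class_of ` (set X \<union> set Y)) \<le> 2" .
    define I where "I = {i. i < 4 \<and> set (seg i) \<inter> set QQ \<noteq> {}}"
    have I_sub: "I \<subseteq> class_of ` (set X \<union> set Y)"
    proof
      fix i assume "i \<in> I"
      then obtain z where "i < 4" "z \<in> set (seg i)" "z \<in> set QQ" by (auto simp: I_def)
      then show "i \<in> class_of ` (set X \<union> set Y)" using segQ class_of_seg by (metis imageI)
    qed
    \<comment> \<open>A segment that misses the second path contributes its first vertex to \<open>N\<close>.\<close>
    have "card ({..<4} - I) \<le> card (N - {p})"
    proof (rule card_inj_on_le)
      show "inj_on (\<lambda>i. hd (seg i)) ({..<4} - I)"
      proof (rule inj_onI)
        fix i j assume i: "i \<in> {..<4} - I" and j: "j \<in> {..<4} - I" and eq: "hd (seg i) = hd (seg j)"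
        show "i = j"
          by (rule seg_disjoint[of i j "hd (seg i)"]) (use i j hd_seg(1)[of i] hd_seg(1)[of j] eq in simp_all)
      qed
      show "(\<lambda>i. hd (seg i)) ` ({..<4} - I) \<subseteq> N - {p}"
      proof (rule image_subsetI)
        fix i assume i: "i \<in> {..<4} - I"
        then have "hd (seg i) \<in> set (seg i)" and disj: "set (seg i) \<inter> set QQ = {}"
          using hd_seg(1)[of i] by (simp_all add: I_def)
        then show "hd (seg i) \<in> N - {p}"
          using seg_in_P[of i "hd (seg i)"] i pS unfolding N_def by blast
      qed
      show "finite (N - {p})" using finN by simp
    qed
    moreover have "card (N - {p}) = m - 1" using pN finN by (simp add: m_def)
    moreover have "card ({..<4} - I) = 4 - card I"
      by (subst card_Diff_subset) (auto simp: I_def)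
    ultimately have I5: "5 \<le> card I + m" using m1 by linarith
    have finX: "finite (class_of ` (set X \<union> set Y))" by simp
    have "card I \<le> 2" using card_mono[OF finX I_sub] two by linarith
    then have m3: "m = 3" and I2: "card I = 2" and k7': "k = 7" using I5 km k7 by auto
    then have ones: "length A0 = 1" "length A3 = 1" using seg_lengths by linarith+
    have "card (set QQ - set P - {q}) = 2" using cQP m3 qP by (simp add: QQ_def)
    then have "set QQ - set P - {q} \<noteq> {}" by (metis card.empty zero_neq_numeral)
    then obtain y where y: "y \<in> set QQ" "y \<notin> set P" "y \<noteq> q" by blast
    have "y \<in> set X \<union> set Y" using y uvS by (auto simp: QQ_def)
    moreover have "class_of y = 4" using y ones by (auto simp: class_of_def)
    ultimately have "insert 4 I \<subseteq> class_of ` (set X \<union> set Y)" using I_sub by (metis imageI insert_subset)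
    then have "card (insert 4 I) \<le> 2" using card_mono[OF finX] two by (meson le_trans)
    moreover have "card (insert 4 I) = 3" using I2 by (subst card_insert_disjoint) (auto simp: I_def)
    ultimately show False by simp
  qed
qed

end

section \<open>Two longest paths cannot be joined on at most ten vertices\<close>

context path_bound
begin

text \<open>
  The case in which \<open>q\<close> has vertices of \<open>P\<close> on both sides along its own path. The nearest ones are
  adjacent to \<open>q\<close> because the stretch between them is trivial, on either side by reversal, and
  with \<open>p\<close> they make up three neighbours of \<open>q\<close> on \<open>P\<close>.
\<close>
lemma no_internal_block:
  assumes P: "path P" "length P = k" and Q: "path (Q1 @ q # Q2)" "length (Q1 @ q # Q2) = k"
    and p: "p \<in> set P" "p \<notin> set (Q1 @ q # Q2)" and q: "q \<notin> set P" and pq: "E p q"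
    and c: "card (set P \<union> set (Q1 @ q # Q2)) \<le> 10"
    and inner: "set Q1 \<inter> set P \<noteq> {}" "set Q2 \<inter> set P \<noteq> {}"
  shows False
proof -
  have k9: "k \<le> 9"
  proof -
    have "card (insert q (set P)) \<le> card (set P \<union> set (Q1 @ q # Q2))" by (rule card_mono) auto
    then show ?thesis using P q c distinct_card[of P] by (simp add: path_def)
  qed
  obtain X u C where Q1: "Q1 = X @ u # C" "u \<in> set P" "set C \<inter> set P = {}"
    using split_list_last_prop[of Q1 "\<lambda>x. x \<in> set P"] inner(1) by (metis disjoint_iff)
  obtain D v Y where Q2: "Q2 = D @ v # Y" "v \<in> set P" "set D \<inter> set P = {}"
    using split_list_first_prop[of Q2 "\<lambda>x. x \<in> set P"] inner(2) by (metis disjoint_iff)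
  have path: "path (X @ u # C @ q # D @ v # Y)" using Q(1) Q1 Q2 by simp
  have C: "C = []"
    by (rule internal_block_trivial[OF P k9 path p(1) Q1(2) Q2(2)]) (use Q1 Q2 p q pq in auto)
  have "path (rev (X @ u # C @ q # D @ v # Y))" using path path_rev by blast
  then have rpath: "path (rev Y @ v # rev D @ q # rev C @ u # rev X)" by simp
  have "rev D = []"
    by (rule internal_block_trivial[OF P k9 rpath p(1) Q2(2) Q1(2)]) (use Q1 Q2 p q pq in auto)
  then have Q_eq: "Q1 @ q # Q2 = X @ [u, q, v] @ Y" using C Q1 Q2 by simp
  have d: "p \<noteq> u" "p \<noteq> v" "u \<noteq> v" using p path by (auto simp: path_def Q1 Q2)
  obtain A0 s1 A1 s2 A2 s3 A3 where
    split: "P = A0 @ s1 # A1 @ s2 # A2 @ s3 # A3" and S: "{s1, s2, s3} = {p, u, v}"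
    using three_members_split[OF p(1) Q1(2) Q2(2) d] by blast
  have "E q u" "E q v"
    using Q(1) unfolding Q_eq
    by (auto simp: path_def successively_append_iff successively_Cons sym_iff)
  then have "\<And>s. s \<in> {p, u, v} \<Longrightarrow> E q s" using pq sym by auto
  then have qs: "E q s1" "E q s2" "E q s3" using S by blast+
  interpret three_neighbours E V k A0 s1 A1 s2 A2 s3 A3 q
    by unfold_locales (use P split q qs Q(1) in \<open>auto simp: path_def\<close>)
  show False
    by (rule no_path_through_two_neighbours[of X u v Y p])
      (use Q Q_eq S p c split in auto)
qed

text \<open>
  Either \<open>q\<close> lies between vertices of \<open>P\<close> along \<open>Q\<close>, or \<open>p\<close> lies between vertices of \<open>Q\<close> along
  \<open>P\<close>, or, after reversals, both lie in tails that avoid the other path.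
\<close>
lemma no_bridge:
  assumes P: "path P" "length P = k" and Q: "path Q" "length Q = k"
    and p: "p \<in> set P" "p \<notin> set Q" and q: "q \<in> set Q" "q \<notin> set P" and pq: "E p q"
    and c: "card (set P \<union> set Q) \<le> 10"
  shows False
proof -
  obtain P1 P2 where P_eq: "P = P1 @ p # P2" using split_list[OF p(1)] by blast
  obtain Q1 Q2 where Q_eq: "Q = Q1 @ q # Q2" using split_list[OF q(1)] by blast
  have q_end: "set Q1 \<inter> set P = {} \<or> set Q2 \<inter> set P = {}"
    using no_internal_block[of P Q1 q Q2 p] assms Q_eq by auto
  have p_end: "set P1 \<inter> set Q = {} \<or> set P2 \<inter> set Q = {}"
    using no_internal_block[of Q P1 p P2 q] assms P_eq sym by (auto simp: Un_commute)
  obtain P1' P2' where P': "path (P1' @ p # P2')" "length (P1' @ p # P2') = k"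
      "set (P1' @ p # P2') = set P" "set P2' \<inter> set Q = {}"
  proof (cases "set P2 \<inter> set Q = {}")
    case True
    then show ?thesis using that[of P1 P2] P P_eq by simp
  next
    case False
    then show ?thesis using that[of "rev P2" "rev P1"] P P_eq p_end path_rev[of P] by auto
  qed
  obtain Q1' Q2' where Q': "path (Q1' @ q # Q2')" "length (Q1' @ q # Q2') = k"
      "set (Q1' @ q # Q2') = set Q" "set Q2' \<inter> set P = {}"
  proof (cases "set Q2 \<inter> set P = {}")
    case True
    then show ?thesis using that[of Q1 Q2] Q Q_eq by simp
  next
    case False
    then show ?thesis using that[of "rev Q2" "rev Q1"] Q Q_eq q_end path_rev[of Q] by auto
  qed
  show False
    by (rule not_both_in_tails[OF P'(1,2) Q'(1,2) pq])
      (use P'(3,4) Q'(3,4) p q in simp_all)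
qed

end

section \<open>From graphs to the abstract setting\<close>
lemma vwalk_arcs_iff_successively:
  "set (vwalk_arcs L) \<subseteq> R \<longleftrightarrow> successively (\<lambda>x y. (x, y) \<in> R) L"
  by (induction L rule: vwalk_arcs.induct) auto

lemma vpath_iff:
  "vpath L (with_proj G) \<longleftrightarrow>
    L \<noteq> [] \<and> distinct L \<and> set L \<subseteq> pverts G \<and> successively (\<lambda>x y. (x, y) \<in> parcs G) L"
  by (auto simp: vpath_def vwalk_def vwalk_arcs_iff_successively)

lemma path_avoiding_nonseparator:
  assumes G: "pair_graph G" and W: "W \<subseteq> pverts G" "\<not> separator G W"
    and ab: "a \<in> pverts G - W" "b \<in> pverts G - W"
  obtains L where "vpath L (with_proj G)" "hd L = a" "last L = b" "set L \<inter> W = {}"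
proof -
  interpret pair_graph G by fact
  let ?H = "with_proj G \<restriction> (pverts G - W)"
  interpret H: wf_digraph ?H by (rule wellformed_induce_subgraph)
  have "connected ?H" using W by (simp add: separator_def)
  moreover have "symmetric ?H"
    using induced_graph_imp_symmetric[OF sym_arcs induced_induce] by auto
  ultimately have "strongly_connected ?H"
    by (intro H.symmetric_connected_imp_strongly_connected)
  then have "a \<rightarrow>\<^sup>*\<^bsub>?H\<^esub> b" using ab by (auto simp: strongly_connected_def)
  then obtain L where L: "vpath L ?H" "hd L = a" "last L = b"
    using H.reachable_vpath_conv by blast
  have "arcs_ends ?H \<subseteq> parcs G" by (auto simp: arcs_ends_conv)
  then have "vpath L (with_proj G)" "set L \<inter> W = {}"
    using L(1) by (auto simp: vpath_def vwalk_def)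
  then show ?thesis using L that by blast
qed

text \<open>
  The stretch from the last visit of \<open>A\<close> to the first visit of \<open>B\<close> thereafter meets
  neither set inside.
\<close>
lemma last_exit_first_entry:
  assumes "hd L \<in> A" "last L \<in> B" "L \<noteq> []" "set L \<inter> (A \<inter> B) = {}"
  obtains L1 p R q L2 where "L = L1 @ p # R @ q # L2" "p \<in> A" "q \<in> B" "set R \<inter> (A \<union> B) = {}"
proof -
  have "\<exists>x\<in>set L. x \<in> A" using assms(1,3) hd_in_set by blast
  then obtain L1 p M where L: "L = L1 @ p # M" and p: "p \<in> A" and M: "\<forall>x\<in>set M. x \<notin> A"
    using split_list_last_prop[of L "\<lambda>x. x \<in> A"] by blast
  have "M \<noteq> []" using assms(2,4) L p by auto
  then have "last M = last L" using L by simp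
  then have "\<exists>x\<in>set M. x \<in> B" using assms(2) \<open>M \<noteq> []\<close> last_in_set by metis
  then obtain R q L2 where "M = R @ q # L2" "q \<in> B" "\<forall>x\<in>set R. x \<notin> B"
    using split_list_first_prop[of M "\<lambda>x. x \<in> B"] by blast
  then show ?thesis using that[of L1 p R q L2] L p M by auto
qed

text \<open>
  A path uses the additional pair \<open>p\<close>, \<open>q\<close> at most once, so cutting there leaves pieces of the
  original relation.
\<close>
lemma successively_new_edge:
  assumes "successively (\<lambda>x y. F x y \<or> x = p \<and> y = q \<or> x = q \<and> y = p) L" "distinct L"
  shows "successively F L \<or>
    (\<exists>L1 L2 a b. L = L1 @ a # b # L2 \<and> {a, b} = {p, q} \<and> successively F (L1 @ [a]) \<and> successively F (b # L2))"
  using assms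
proof (induction L)
  case (Cons x L)
  show ?case
  proof (cases L)
    case (Cons y M)
    have IH: "successively F L \<or> (\<exists>L1 L2 a b. L = L1 @ a # b # L2 \<and> {a, b} = {p, q} \<and>
        successively F (L1 @ [a]) \<and> successively F (b # L2))"
      using Cons.IH Cons.prems by (auto simp: successively_Cons)
    show ?thesis
    proof (cases "F x y")
      case True
      from IH show ?thesis
      proof (elim disjE exE conjE)
        assume "successively F L"
        then show ?thesis using True Cons by simp
      next
        fix L1 L2 a b
        assume *: "L = L1 @ a # b # L2" "{a, b} = {p, q}" "successively F (L1 @ [a])"
          "successively F (b # L2)"
        have "hd (L1 @ [a]) = y" using *(1) Cons by (cases L1) auto
        then have "successively F ((x # L1) @ [a])"
          using *(3) True by (cases L1) auto
        then show ?thesis using * by (metis append_Cons)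
      qed
    next
      case False
      then have xy: "{x, y} = {p, q}" using Cons.prems(1) Cons by auto
      have "x \<notin> set L" using Cons.prems(2) by simp
      have "successively F L"
      proof -
        have "successively F (y # M)"
        proof (rule successively_mono[of "\<lambda>u v. F u v \<or> u = p \<and> v = q \<or> u = q \<and> v = p"])
          show "successively (\<lambda>u v. F u v \<or> u = p \<and> v = q \<or> u = q \<and> v = p) (y # M)"
            using Cons.prems(1) Cons by simp
          fix u v assume "u \<in> set (y # M)" "v \<in> set (y # M)"
            "F u v \<or> u = p \<and> v = q \<or> u = q \<and> v = p"
          then show "F u v" using xy \<open>x \<notin> set L\<close> Cons by (auto simp: doubleton_eq_iff)
        qed
        then show ?thesis using Cons by simp
      qed
      then have "x # L = [] @ x # y # M \<and> {x, y} = {p, q} \<and> successively F ([] @ [x]) \<and> successively F (y # M)"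
        using xy Cons by simp
      then show ?thesis by blast
    qed
  qed simp
qed simp

text \<open>
  If the complement of the intersection is connected, it contains a path \<open>R\<close> from some \<open>p\<close> on \<open>P\<close>
  to some \<open>q\<close> on \<open>Q\<close> that meets neither path inside. Discarding everything but the two paths and
  replacing \<open>R\<close> by a single edge keeps the paths short: a path over the new edge becomes only longer
  when \<open>R\<close> is put back.
\<close>
lemma intersection_is_separator:
  fixes G :: "'a pair_pre_digraph"
  assumes G: "pair_graph G" and n: "card (pverts G) \<le> 10"
    and P: "longest_path G P" and Q: "longest_path G Q" and ne: "set P \<noteq> set Q"
  shows "separator G (set P \<inter> set Q)"
proof (rule ccontr)
  assume nsep: "\<not> separator G (set P \<inter> set Q)"
  interpret pair_graph G by fact
  let ?F = "\<lambda>x y. (x, y) \<in> parcs G"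
  have symF: "?F x y \<Longrightarrow> ?F y x" for x y by (rule arcs_symmetric)
  have vP: "vpath P (with_proj G)" and vQ: "vpath Q (with_proj G)"
    using P Q by (simp_all add: longest_path_def)
  have neP: "P \<noteq> []" "Q \<noteq> []" using vP vQ by (simp_all add: vpath_iff)
  have bound: "length L \<le> length P" if "vpath L (with_proj G)" for L
  proof -
    have "length L - 1 \<le> length P - 1" using P that by (auto simp: longest_path_def)
    then show ?thesis using neP by (cases P) auto
  qed
  have "length P \<le> length Q"
  proof -
    have "length P - 1 \<le> length Q - 1" using Q vP by (auto simp: longest_path_def)
    then show ?thesis using neP by (cases Q) auto
  qed
  then have len: "length Q = length P" using bound[OF vQ] by simp
  have dP: "distinct P" and dQ: "distinct Q" and sP: "set P \<subseteq> pverts G" and sQ: "set Q \<subseteq> pverts G"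
    using vP vQ by (simp_all add: vpath_iff)
  have cc: "card (set P) = card (set Q)" using dP dQ len by (simp add: distinct_card)
  obtain a where a: "a \<in> set P" "a \<notin> set Q"
    using card_subset_eq[of "set Q" "set P"] cc ne by auto
  obtain b where b: "b \<in> set Q" "b \<notin> set P"
    using card_subset_eq[of "set P" "set Q"] cc ne by auto
  obtain L where L: "vpath L (with_proj G)" "hd L = a" "last L = b" "set L \<inter> (set P \<inter> set Q) = {}"
    using path_avoiding_nonseparator[OF G _ nsep, of a b] a b sP sQ by auto
  obtain L1 p R q L2 where L_eq: "L = L1 @ p # R @ q # L2" and pq: "p \<in> set P" "q \<in> set Q"
    and R: "set R \<inter> (set P \<union> set Q) = {}"
    by (rule last_exit_first_entry[of L "set P" "set Q"]) (use L a b in \<open>auto simp: vpath_iff\<close>)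
  have pq': "p \<notin> set Q" "q \<notin> set P" using L(4) L_eq pq by auto
  have link: "distinct (p # R @ [q])" "successively ?F (p # R @ [q])" "set R \<subseteq> pverts G"
    using L(1) unfolding L_eq vpath_iff
    by (auto simp: successively_append_iff successively_Cons hd_append split: if_splits)
  define E where "E x y \<longleftrightarrow> ?F x y \<or> x = p \<and> y = q \<or> x = q \<and> y = p" for x y
  have rev_link: "successively ?F (q # rev R @ [p])"
  proof -
    have "successively ?F (rev (p # R @ [q]))"
      unfolding successively_rev by (rule successively_mono[OF link(2)]) (use symF in auto)
    then show ?thesis by simp
  qed
  interpret path_bound E "set P \<union> set Q" "length P"
  proof
    show "E y x" if "E x y" for x y using that symF by (auto simp: E_def)
    fix M :: "'a list"
    assume M: "distinct M" "successively E M" "set M \<subseteq> set P \<union> set Q"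
    have "successively (\<lambda>x y. ?F x y \<or> x = p \<and> y = q \<or> x = q \<and> y = p) M"
      using M(2) by (simp add: E_def[abs_def])
    from successively_new_edge[OF this M(1)] show "length M \<le> length P"
    proof (elim disjE exE conjE)
      assume "successively ?F M"
      then show ?thesis using bound[of M] M sP sQ by (cases "M = []") (auto simp: vpath_iff)
    next
      fix M1 M2 c d
      assume *: "M = M1 @ c # d # M2" "{c, d} = {p, q}" "successively ?F (M1 @ [c])"
        "successively ?F (d # M2)"
      obtain R' where R': "successively ?F (c # R' @ [d])" "set R' = set R" "distinct R'"
        using that link rev_link *(2) by (auto simp: doubleton_eq_iff)
      have "successively ?F (M1 @ c # R' @ d # M2)"
        using *(3,4) R'(1)
        by (auto simp: successively_append_iff successively_Cons hd_append split: if_splits)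
      then have "vpath (M1 @ c # R' @ d # M2) (with_proj G)"
        unfolding vpath_iff using M(1,3) *(1) R'(2,3) R link(3) sP sQ by auto
      then show ?thesis using bound[of "M1 @ c # R' @ d # M2"] *(1) by simp
    qed
  qed
  have "successively E L" if "successively ?F L" for L
    by (rule successively_mono[OF that]) (auto simp: E_def)
  then have "path P" "path Q" using vP vQ by (auto simp: path_def vpath_iff)
  moreover have "card (set P \<union> set Q) \<le> 10"
    using card_mono[OF pair_finite_verts, of "set P \<union> set Q"] sP sQ n by auto
  ultimately show False using no_bridge[of P Q p q] len pq pq' by (simp add: E_def)
qed

section \<open>A graph with eleven vertices\<close>

text \<open>
  The Petersen graph with one vertex deleted, whose three neighbours were \<open>1\<close>, \<open>4\<close> and \<open>8\<close>, and
  with pendant vertices \<open>0\<close> at \<open>1\<close> and \<open>9\<close> at \<open>8\<close>. A Hamiltonian path would lead from \<open>0\<close> to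
  \<open>9\<close>, and closing it up through the deleted vertex would give a Hamiltonian cycle of the Petersen
  graph.
\<close>
definition cut_petersen_nbrs :: "nat \<Rightarrow> nat list" where
  "cut_petersen_nbrs v =
    [[1], [0, 2, 6], [1, 3, 10], [2, 4, 7], [3, 5], [4, 6, 10], [5, 7, 1], [6, 8, 3], [7, 9, 10],
     [8], [8, 5, 2]] ! v"

definition cut_petersen :: "nat pair_pre_digraph" where
  "cut_petersen = \<lparr>pverts = {..<11}, parcs = {(u, v). u < 11 \<and> v \<in> set (cut_petersen_nbrs u)}\<rparr>"

text \<open>
  The list holds the vertices visited so far, the current one first; the search asks for the given
  number of further vertices.
\<close>
primrec extendable :: "nat \<Rightarrow> nat list \<Rightarrow> bool" where
  "extendable 0 xs = True"
| "extendable (Suc n) xs =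
    list_ex (\<lambda>y. y \<notin> set xs \<and> extendable n (y # xs)) (cut_petersen_nbrs (hd xs))"

lemma extendable_if_path:
  assumes "xs \<noteq> []" "distinct (rev xs @ ys)"
    "successively (\<lambda>u v. (u, v) \<in> parcs cut_petersen) (rev xs @ ys)"
  shows "extendable (length ys) xs"
  using assms
proof (induction ys arbitrary: xs)
  case (Cons y ys)
  have "extendable (length ys) (y # xs)" by (rule Cons.IH) (use Cons.prems in auto)
  moreover have "y \<in> set (cut_petersen_nbrs (hd xs))"
    using Cons.prems by (auto simp: successively_append_iff last_rev cut_petersen_def)
  ultimately show ?case using Cons.prems by (auto simp: list_ex_iff)
qed simp

lemma not_extendable_from_leaf: "\<not> extendable 10 [0]"
  by code_simp

lemma pair_graph_cut_petersen: "pair_graph cut_petersen"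
proof -
  have arcs: "\<forall>u\<in>set [0..<11]. \<forall>v\<in>set (cut_petersen_nbrs u).
      v \<in> set [0..<11] \<and> u \<noteq> v \<and> u \<in> set (cut_petersen_nbrs v)"
    by code_simp
  have parcs: "(u, v) \<in> parcs cut_petersen \<longleftrightarrow> u \<in> set [0..<11] \<and> v \<in> set (cut_petersen_nbrs u)" for u v
    by (simp add: cut_petersen_def)
  have arcs': "u < 11 \<and> v < 11 \<and> u \<noteq> v \<and> (v, u) \<in> parcs cut_petersen"
    if "(u, v) \<in> parcs cut_petersen" for u v
  proof -
    have "u \<in> set [0..<11] \<and> v \<in> set [0..<11] \<and> u \<noteq> v \<and> (v, u) \<in> parcs cut_petersen"
      using that arcs unfolding parcs by blast
    then show ?thesis by simp
  qed
  have "parcs cut_petersen \<subseteq> {..<11} \<times> {..<11}" using arcs' by auto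
  then have "finite (parcs cut_petersen)" by (rule finite_subset) simp
  have pverts: "pverts cut_petersen = {..<11}" by (simp add: cut_petersen_def)
  show ?thesis
  proof unfold_locales
    fix e assume "e \<in> parcs cut_petersen"
    then have e: "fst e < 11 \<and> snd e < 11 \<and> fst e \<noteq> snd e"
      using arcs'[of "fst e" "snd e"] by simp
    show "fst e \<in> pverts cut_petersen" "snd e \<in> pverts cut_petersen" "fst e \<noteq> snd e"
      using e by (simp_all add: pverts)
  next
    show "finite (pverts cut_petersen)" by (simp add: pverts)
    show "finite (parcs cut_petersen)" by fact
    show "symmetric (with_proj cut_petersen)"
      unfolding symmetric_def with_proj_simps by (rule symI) (use arcs' in blast)
  qed
qed

text \<open>
  The leaf \<open>0\<close> is an end of every Hamiltonian path, so that the exhaustive search from \<open>0\<close> decides.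
\<close>
lemma cut_petersen_path_length:
  assumes "vpath L (with_proj cut_petersen)"
  shows "length L \<le> 10"
proof (rule ccontr)
  interpret pair_graph cut_petersen by (rule pair_graph_cut_petersen)
  assume "\<not> length L \<le> 10"
  have L: "L \<noteq> []" "distinct L" "set L \<subseteq> {..<11}"
    "successively (\<lambda>u v. (u, v) \<in> parcs cut_petersen) L"
    using assms by (auto simp: vpath_iff cut_petersen_def)
  have "card (set L) \<le> 11" using card_mono[OF _ L(3)] by simp
  then have "length L = 11" using \<open>\<not> length L \<le> 10\<close> distinct_card[OF L(2)] by simp
  moreover from this have "card (set L) = card {..<11 :: nat}" using distinct_card[OF L(2)] by simp
  then have "0 \<in> set L" using card_subset_eq[OF _ L(3)] by auto
  then obtain A B where split: "L = A @ 0 # B" using split_list by metis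
  have leaf: "v = 1" if "(0, v) \<in> parcs cut_petersen \<or> (v, 0) \<in> parcs cut_petersen" for v
    using that arcs_symmetric[of v 0] by (auto simp: cut_petersen_def cut_petersen_nbrs_def)
  have "A = [] \<or> B = []"
  proof (rule ccontr)
    assume "\<not> (A = [] \<or> B = [])"
    then have ne: "A \<noteq> []" "B \<noteq> []" by auto
    then have "(last A, 0) \<in> parcs cut_petersen" "(0, hd B) \<in> parcs cut_petersen"
      using L(4) split by (auto simp: successively_append_iff successively_Cons)
    then have "last A = hd B" using leaf by metis
    moreover have "last A \<in> set A" "hd B \<in> set B" using ne by simp_all
    ultimately show False using L(2) split by auto
  qed
  then obtain ys where "vpath (0 # ys) (with_proj cut_petersen)" "length (0 # ys) = length L"
  proof
    assume "A = []"
    then show ?thesis using that[of B] assms split by simp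
  next
    assume "B = []"
    have "vpath (rev L) (with_proj cut_petersen)"
      using assms vwalk_rev_ex[OF sym_arcs] by (simp add: vpath_def)
    then show ?thesis using that[of "rev A"] split \<open>B = []\<close> by simp
  qed
  ultimately have "extendable 10 [0]"
    using extendable_if_path[of "[0]" ys] by (simp add: vpath_iff)
  then show False using not_extendable_from_leaf by simp
qed

lemma cut_petersen_nonseparating:
  defines "P \<equiv> [0, 1, 2, 3, 4, 5, 6, 7, 8, 9]" and "Q \<equiv> [0, 1, 6, 7, 3, 4, 5, 10, 8, 9]"
  shows "longest_path cut_petersen P" "longest_path cut_petersen Q" "set Q \<noteq> set P"
    "\<not> separator cut_petersen (set Q \<inter> set P)"
proof -
  have pP: "vpath P (with_proj cut_petersen)" and pQ: "vpath Q (with_proj cut_petersen)"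
    by (simp_all add: vpath_iff P_def Q_def cut_petersen_def cut_petersen_nbrs_def)
  have lens: "length P = 10" "length Q = 10" by (simp_all add: P_def Q_def)
  have "length L - 1 \<le> 9" if "vpath L (with_proj cut_petersen)" for L
    using cut_petersen_path_length[OF that] by simp
  then show "longest_path cut_petersen P" "longest_path cut_petersen Q"
    using pP pQ lens by (simp_all add: longest_path_def)
  have "2 \<in> set P" "2 \<notin> set Q" by (simp_all add: P_def Q_def)
  then show "set Q \<noteq> set P" by blast
  have rest: "pverts cut_petersen - (set Q \<inter> set P) = {2, 10}"
    by (auto simp: cut_petersen_def P_def Q_def) presburger
  have e: "(2, 10) \<in> parcs cut_petersen" "(10, 2) \<in> parcs cut_petersen"
    by (simp_all add: cut_petersen_def cut_petersen_nbrs_def)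
  let ?H = "with_proj cut_petersen \<restriction> {2, 10}"
  have "(2, 10) \<in> arcs_ends ?H" "(10, 2) \<in> arcs_ends ?H"
    using e by (auto simp: arcs_ends_conv image_iff)
  then have s: "(2, 10) \<in> (arcs_ends ?H)\<^sup>s" "(10, 2) \<in> (arcs_ends ?H)\<^sup>s"
    by (auto simp: symcl_def)
  have "(2, 10) \<in> rtrancl_on {2, 10} ((arcs_ends ?H)\<^sup>s)" "(10, 2) \<in> rtrancl_on {2, 10} ((arcs_ends ?H)\<^sup>s)"
    by (rule rtrancl_on_into_rtrancl_on[OF rtrancl_on_refl s(1)], simp_all)
      (rule rtrancl_on_into_rtrancl_on[OF rtrancl_on_refl s(2)], simp_all)
  then have "\<forall>u\<in>{2, 10}. \<forall>v\<in>{2, 10}. (u, v) \<in> rtrancl_on {2, 10} ((arcs_ends ?H)\<^sup>s)"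
    by simp
  then have "connected ?H" unfolding connected_conv by simp
  then show "\<not> separator cut_petersen (set Q \<inter> set P)"
    unfolding separator_def rest by simp
qed

theorem corollary3p3:
  shows
    "(\<forall>(G :: 'a pair_pre_digraph) P Q.
        pair_graph G \<and> card (pverts G) \<le> 10 \<and>
        longest_path G P \<and> longest_path G Q \<and> set Q \<noteq> set P
        \<longrightarrow> separator G (set Q \<inter> set P))
     \<and>
     (\<exists>(G :: nat pair_pre_digraph) P Q.
        pair_graph G \<and> card (pverts G) = 11 \<and>
        longest_path G P \<and> longest_path G Q \<and> set Q \<noteq> set P \<and>
        \<not> separator G (set Q \<inter> set P))
     \<and>
     (LEAST n. \<exists>(G :: nat pair_pre_digraph) P Q.
        pair_graph G \<and> card (pverts G) = n \<and>
        longest_path G P \<and> longest_path G Q \<and> set P \<noteq> set Q \<and>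
        \<not> separator G (set P \<inter> set Q)) = 11"
proof (intro conjI)
  show "\<forall>(G :: 'a pair_pre_digraph) P Q.
      pair_graph G \<and> card (pverts G) \<le> 10 \<and>
      longest_path G P \<and> longest_path G Q \<and> set Q \<noteq> set P
      \<longrightarrow> separator G (set Q \<inter> set P)"
    using intersection_is_separator by blast
  have ex: "\<exists>P Q. pair_graph cut_petersen \<and> card (pverts cut_petersen) = 11 \<and>
      longest_path cut_petersen P \<and> longest_path cut_petersen Q \<and> set Q \<noteq> set P \<and>
      \<not> separator cut_petersen (set Q \<inter> set P)"
    using cut_petersen_nonseparating pair_graph_cut_petersen
    by (intro exI conjI) (assumption | simp add: cut_petersen_def)+
  then show "\<exists>(G :: nat pair_pre_digraph) P Q.
      pair_graph G \<and> card (pverts G) = 11 \<and>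
      longest_path G P \<and> longest_path G Q \<and> set Q \<noteq> set P \<and>
      \<not> separator G (set Q \<inter> set P)" by blast
  show "(LEAST n. \<exists>(G :: nat pair_pre_digraph) P Q.
      pair_graph G \<and> card (pverts G) = n \<and>
      longest_path G P \<and> longest_path G Q \<and> set P \<noteq> set Q \<and>
      \<not> separator G (set P \<inter> set Q)) = 11"
  proof (rule Least_equality)
    show "\<exists>(G :: nat pair_pre_digraph) P Q.
      pair_graph G \<and> card (pverts G) = 11 \<and>
      longest_path G P \<and> longest_path G Q \<and> set P \<noteq> set Q \<and>
      \<not> separator G (set P \<inter> set Q)" using ex by blast
    fix n assume "\<exists>(G :: nat pair_pre_digraph) P Q.
      pair_graph G \<and> card (pverts G) = n \<and>
      longest_path G P \<and> longest_path G Q \<and> set P \<noteq> set Q \<and>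
      \<not> separator G (set P \<inter> set Q)"
    then have "\<not> n \<le> 10" using intersection_is_separator by blast
    then show "11 \<le> n" by simp
  qed
qed

end
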